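(* For every integer $n\ge 5$, the path $P_n$ on $n$ vertices satisfies $\mathrm{mpd}(P_n)=4$.
   Context: $d(u,v)$ denotes the shortest-path distance. Let $G$ be a connected graph and let $\Pi=\{S_1,\dots,S_t\}$ be a partition of $V(G)$ into nonempty parts. For $v\in V(G)$ put $d(v,S_i)=\min\{d(v,x):x\in S_i\}$. The multiset partition representation of $v$ with respect to $\Pi$ is the multiset $r_{mp}(v\mid\Pi)=\{d(v,S_1),\dots,d(v,S_t)\}$ (order ignored, multiplicities kept). $\Pi$ is a resolving multiset partition if $r_{mp}(u\mid\Pi)\ne r_{mp}(v\mid\Pi)$ for all distinct $u,v\in V(G)$. The multiset partition dimension $\mathrm{mpd}(G)$ is the minimum number $t$ of parts of a resolving multiset partition of $G$, and $\mathrm{mpd}(G)=\infty$ if none exists. *)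

theory Defs
  imports Main "HOL-Library.Multiset" "HOL-Library.Disjoint_Sets" "HOL-Library.Extended_Nat"
begin

record 'a graph =
  verts :: "'a set"
  edges :: "'a set set"

definition simple_graph :: "'a graph \<Rightarrow> bool" where
  "simple_graph G \<longleftrightarrow> (\<forall>e\<in>edges G. \<exists>u\<in>verts G. \<exists>v\<in>verts G. u \<noteq> v \<and> e = {u, v})"

text \<open>A path is given by its nonempty list of vertices; its length is the number of edges,
  one less than the length of the list.\<close>

definition is_path :: "'a graph \<Rightarrow> 'a \<Rightarrow> 'a list \<Rightarrow> 'a \<Rightarrow> bool" where
  "is_path G u p v \<longleftrightarrow>
     p \<noteq> [] \<and> hd p = u \<and> last p = v \<and> set p \<subseteq> verts G \<and> distinct p \<and>
     (\<forall>i. Suc i < length p \<longrightarrow> {p ! i, p ! Suc i} \<in> edges G)"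

definition connected_graph :: "'a graph \<Rightarrow> bool" where
  "connected_graph G \<longleftrightarrow>
     simple_graph G \<and> verts G \<noteq> {} \<and> (\<forall>u\<in>verts G. \<forall>v\<in>verts G. \<exists>p. is_path G u p v)"

text \<open>The distances below are meaningful for vertices of a connected graph and for nonempty
  sets of vertices; otherwise the minimum may range over the empty set and is then
  unspecified (for \<open>LEAST\<close>) or 0 (for \<open>INF\<close> on natural numbers).\<close>

definition gdist :: "'a graph \<Rightarrow> 'a \<Rightarrow> 'a \<Rightarrow> nat" where
  "gdist G u v = (LEAST k. \<exists>p. is_path G u p v \<and> length p = Suc k)"

definition gdist_set :: "'a graph \<Rightarrow> 'a \<Rightarrow> 'a set \<Rightarrow> nat" where
  "gdist_set G v S = (INF x\<in>S. gdist G v x)"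

definition r_mp :: "'a graph \<Rightarrow> 'a set set \<Rightarrow> 'a \<Rightarrow> nat multiset" where
  "r_mp G P v = image_mset (gdist_set G v) (mset_set P)"

definition resolving_multiset_partition :: "'a graph \<Rightarrow> 'a set set \<Rightarrow> bool" where
  "resolving_multiset_partition G P \<longleftrightarrow>
     finite P \<and> partition_on (verts G) P \<and>
     (\<forall>u\<in>verts G. \<forall>v\<in>verts G. u \<noteq> v \<longrightarrow> r_mp G P u \<noteq> r_mp G P v)"

text \<open>The infimum of the empty set in \<^typ>\<open>enat\<close> is \<open>\<infinity>\<close>.\<close>

definition mpd :: "'a graph \<Rightarrow> enat" where
  "mpd G = (INF P\<in>{P. resolving_multiset_partition G P}. enat (card P))"

definition path_graph :: "nat \<Rightarrow> nat graph" where
  "path_graph n = \<lparr>verts = {0..<n}, edges = {{i, Suc i} |i. Suc i < n}\<rparr>"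

lemma simple_graph_path_graph: "simple_graph (path_graph n)"
  unfolding simple_graph_def
proof
  fix e assume "e \<in> edges (path_graph n)"
  then obtain i where "e = {i, Suc i}" "Suc i < n"
    by (auto simp: path_graph_def)
  then have "i \<in> verts (path_graph n)" "Suc i \<in> verts (path_graph n)" "i \<noteq> Suc i"
    by (simp_all add: path_graph_def)
  with \<open>e = {i, Suc i}\<close> show "\<exists>u\<in>verts (path_graph n). \<exists>v\<in>verts (path_graph n). u \<noteq> v \<and> e = {u, v}"
    by blast
qed

lemma is_path_rev:
  assumes "is_path G u p v"
  shows "is_path G v (rev p) u"
  unfolding is_path_def
proof (intro conjI allI impI)
  fix i assume i: "Suc i < length (rev p)"
  define j where "j = length p - Suc (Suc i)"
  have "Suc j < length p" "rev p ! i = p ! Suc j" "rev p ! Suc i = p ! j"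
    using i by (auto simp: j_def rev_nth Suc_diff_Suc)
  then show "{rev p ! i, rev p ! Suc i} \<in> edges G"
    using assms by (simp add: is_path_def insert_commute)
qed (use assms in \<open>auto simp: is_path_def hd_rev last_rev\<close>)

lemma connected_graph_path_graph:
  assumes "n \<ge> 1"
  shows "connected_graph (path_graph n)"
proof -
  have up: "is_path (path_graph n) u [u..<Suc v] v" if "u \<le> v" "v < n" for u v
    unfolding is_path_def
  proof (intro conjI allI impI)
    fix i assume "Suc i < length [u..<Suc v]"
    then have "[u..<Suc v] ! i = u + i" "[u..<Suc v] ! Suc i = Suc (u + i)" "Suc (u + i) < n"
      using that by (simp_all del: upt_Suc)
    then show "{[u..<Suc v] ! i, [u..<Suc v] ! Suc i} \<in> edges (path_graph n)"
      unfolding path_graph_def by auto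
  qed (use that in \<open>auto simp: path_graph_def hd_append\<close>)
  have "\<exists>p. is_path (path_graph n) u p v" if "u < n" "v < n" for u v
    using up[of u v] is_path_rev[OF up[of v u]] that by (cases "u \<le> v") auto
  moreover have "verts (path_graph n) = {0..<n}"
    by (simp add: path_graph_def)
  ultimately show ?thesis
    using assms simple_graph_path_graph[of n] by (simp add: connected_graph_def)
qed

end

theory Submission imports Defs begin

text \<open>Four parts suffice: with respect to \<open>{0}, {1, 2}, {3}, {4, \<dots>, n - 1}\<close>, the sums of the
  squares of the four distances are 26, 14, 9, 11 for the vertices 0, 1, 2, 3 and
  \<open>v\<^sup>2 + (v - 2)\<^sup>2 + (v - 3)\<^sup>2\<close> (that is, 21, 38, \<open>\<dots>\<close>) for \<open>v \<ge> 4\<close>, hence pairwise distinct.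

  Three parts never suffice: take a shortest segment \<open>p, \<dots>, q\<close> that meets all three parts. By
  minimality \<open>p\<close> and \<open>q\<close> lie in different parts and everything strictly between them in the third
  part. The inner neighbours of \<open>p\<close> and \<open>q\<close> have the same representation \<open>{0, 1, q - p - 1}\<close>, so
  they coincide, i.e. \<open>q = p + 2\<close>. The representations of \<open>p\<close>, \<open>p + 1\<close>, \<open>q\<close> are then
  \<open>{0, 1, x}\<close>, \<open>{0, 1, 1}\<close>, \<open>{0, 1, y}\<close> with \<open>x, y \<in> {1, 2}\<close>, and two of them agree.\<close>

section \<open>Distances in the path graph\<close>

lemma verts_path_graph [simp]: "verts (path_graph n) = {0..<n}"
  by (simp add: path_graph_def)

lemma is_path_path_graph_upt:
  assumes "u \<le> v" "v < n"
  shows "is_path (path_graph n) u [u..<Suc v] v"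
  unfolding is_path_def
proof (intro conjI allI impI)
  fix i assume "Suc i < length [u..<Suc v]"
  then have "[u..<Suc v] ! i = u + i" "[u..<Suc v] ! Suc i = Suc (u + i)" "Suc (u + i) < n"
    using assms by (simp_all del: upt_Suc)
  then show "{[u..<Suc v] ! i, [u..<Suc v] ! Suc i} \<in> edges (path_graph n)"
    unfolding path_graph_def by auto
qed (use assms in \<open>auto simp: hd_append\<close>)

text \<open>Every edge changes the vertex number by exactly 1, so \<open>i\<close> steps move by at
  most \<open>i\<close>. This bounds path lengths from below when distances are computed.\<close>

lemma is_path_path_graph_nth_le:
  assumes "is_path (path_graph n) u p v" "i < length p"
  shows "p ! i \<le> u + i \<and> u \<le> p ! i + i"
  using assms(2)
proof (induction i)
  case 0
  then show ?case
    using assms(1) by (simp add: is_path_def hd_conv_nth)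
next
  case (Suc i)
  have "{p ! i, p ! Suc i} \<in> edges (path_graph n)"
    using assms(1) Suc.prems by (simp add: is_path_def)
  then have "p ! Suc i = Suc (p ! i) \<or> p ! i = Suc (p ! Suc i)"
    by (auto simp: path_graph_def doubleton_eq_iff)
  then show ?case
    using Suc by auto
qed

text \<open>Subtraction on \<^typ>\<open>nat\<close> truncates, so the right-hand side is \<open>\<bar>u - v\<bar>\<close>.\<close>

lemma gdist_path_graph:
  assumes "u < n" "v < n"
  shows "gdist (path_graph n) u v = (u - v) + (v - u)"
  unfolding gdist_def
proof (rule Least_equality)
  show "\<exists>p. is_path (path_graph n) u p v \<and> length p = Suc ((u - v) + (v - u))"
  proof (cases "u \<le> v")
    case True
    then show ?thesis
      using is_path_path_graph_upt[of u v n] assms by (intro exI[of _ "[u..<Suc v]"]) auto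
  next
    case False
    then show ?thesis
      using is_path_rev[OF is_path_path_graph_upt[of v u n]] assms
      by (intro exI[of _ "rev [v..<Suc u]"]) auto
  qed
next
  fix k assume "\<exists>p. is_path (path_graph n) u p v \<and> length p = Suc k"
  then obtain p where p: "is_path (path_graph n) u p v" "length p = Suc k"
    by blast
  moreover have "p ! k = v"
    using p by (auto simp: is_path_def last_conv_nth)
  ultimately show "(u - v) + (v - u) \<le> k"
    using is_path_path_graph_nth_le[of n u p v k] by auto
qed

text \<open>An infimum of naturals is a minimum once it is attained: \<open>x\<close> attains
  \<open>k\<close>, the last premise bounds all of \<open>S\<close>. All distances to parts are
  reduced to linear arithmetic this way.\<close>

lemma gdist_set_path_graph_eqI:
  assumes "S \<subseteq> {0..<n}" "v < n" "x \<in> S" "(v - x) + (x - v) = k"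
    and "\<And>y. y \<in> S \<Longrightarrow> k \<le> (v - y) + (y - v)"
  shows "gdist_set (path_graph n) v S = k"
  unfolding gdist_set_def
proof (rule cInf_eq_minimum)
  show "k \<in> gdist (path_graph n) v ` S"
    using assms(1-4) by (auto simp: gdist_path_graph intro!: rev_image_eqI[of x])
next
  fix d assume "d \<in> gdist (path_graph n) v ` S"
  then obtain y where "y \<in> S" "d = gdist (path_graph n) v y" by blast
  moreover from this have "y < n" using assms(1) by auto
  ultimately show "k \<le> d"
    using assms(2,5) by (simp add: gdist_path_graph)
qed

lemma gdist_set_path_graph_in:
  assumes "S \<subseteq> {0..<n}" "v \<in> S"
  shows "gdist_set (path_graph n) v S = 0"
  using assms by (intro gdist_set_path_graph_eqI[of _ _ _ v]) auto

lemma gdist_set_path_graph_adjacent: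
  assumes "S \<subseteq> {0..<n}" "v < n" "v \<notin> S" "x \<in> S" "x = Suc v \<or> v = Suc x"
  shows "gdist_set (path_graph n) v S = 1"
proof (rule gdist_set_path_graph_eqI[of _ _ _ x])
  fix y assume "y \<in> S"
  with assms(3) have "y \<noteq> v" by blast
  then show "1 \<le> (v - y) + (y - v)" by linarith
qed (use assms in auto)

text \<open>The vertex \<open>x\<close> gives the upper bound 2, but \<open>S\<close> may also
  contain a neighbour of \<open>v\<close>, for instance on the side away from \<open>x\<close>;
  hence two possible values.\<close>

lemma gdist_set_path_graph_distance_two:
  assumes "S \<subseteq> {0..<n}" "v < n" "v \<notin> S" "x \<in> S" "x = v + 2 \<or> v = x + 2"
  shows "gdist_set (path_graph n) v S \<in> {1, 2}"
proof (cases "\<exists>y\<in>S. y = Suc v \<or> v = Suc y")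
  case True
  then show ?thesis
    using gdist_set_path_graph_adjacent[OF assms(1-3)] by blast
next
  case False
  have "gdist_set (path_graph n) v S = 2"
  proof (rule gdist_set_path_graph_eqI[of _ _ _ x])
    fix y assume "y \<in> S"
    with False assms(3) have "y \<noteq> v" "y \<noteq> Suc v" "v \<noteq> Suc y" by blast+
    then show "2 \<le> (v - y) + (y - v)" by linarith
  qed (use assms in auto)
  then show ?thesis by simp
qed

section \<open>Lower bound: fewer than four parts never resolve\<close>

lemma r_mp_insert2:
  assumes "A \<noteq> B"
  shows "r_mp G {A, B} v = {#gdist_set G v A, gdist_set G v B#}"
  using assms by (simp add: r_mp_def)

lemma r_mp_insert3:
  assumes "A \<noteq> B" "A \<noteq> C" "B \<noteq> C"
  shows "r_mp G {A, B, C} v = {#gdist_set G v A, gdist_set G v B, gdist_set G v C#}"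
  using assms by (simp add: r_mp_def)

text \<open>Two consecutive vertices in different parts both have the representation
  \<open>{#0, 1#}\<close>.\<close>

lemma not_resolving_two_parts:
  assumes "card P = 2"
  shows "\<not> resolving_multiset_partition (path_graph n) P"
proof
  assume res: "resolving_multiset_partition (path_graph n) P"
  then have part: "partition_on {0..<n} P"
    by (simp add: resolving_multiset_partition_def)
  obtain A B where P: "P = {A, B}" "A \<noteq> B"
    using assms by (auto simp: card_2_iff)
  have sub: "A \<subseteq> {0..<n}" "B \<subseteq> {0..<n}" and un: "A \<union> B = {0..<n}"
    using partition_onD1[OF part] P by auto
  have disj: "A \<inter> B = {}"
    using partition_onD2[OF part] P by (simp add: disjoint_def)
  have "A \<noteq> {}" "B \<noteq> {}"
    using partition_onD3[OF part] P by auto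
  \<comment> \<open>Otherwise membership in \<open>A\<close> would be constant along the path,
    leaving \<open>A\<close> or \<open>B\<close> empty.\<close>
  have "\<exists>i. Suc i < n \<and> (i \<in> A \<longleftrightarrow> Suc i \<notin> A)"
  proof (rule ccontr)
    assume "\<not> ?thesis"
    then have step: "Suc i < n \<Longrightarrow> Suc i \<in> A \<longleftrightarrow> i \<in> A" for i by blast
    have const: "i < n \<Longrightarrow> i \<in> A \<longleftrightarrow> 0 \<in> A" for i
      by (induction i) (auto simp: step)
    obtain a b where "a \<in> A" "b \<in> B"
      using \<open>A \<noteq> {}\<close> \<open>B \<noteq> {}\<close> by blast
    moreover from this have "a < n" "b < n"
      using sub by auto
    ultimately show False
      using const[of a] const[of b] disj by blast
  qed
  then obtain i where i: "Suc i < n" "i \<in> A \<longleftrightarrow> Suc i \<notin> A" by blast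
  have mem: "i \<in> A \<and> i \<notin> B \<and> Suc i \<in> B \<and> Suc i \<notin> A \<or> i \<in> B \<and> i \<notin> A \<and> Suc i \<in> A \<and> Suc i \<notin> B"
  proof -
    have "i \<in> A \<union> B" "Suc i \<in> A \<union> B" using i(1) un by auto
    then show ?thesis using i(2) disj by blast
  qed
  have "r_mp (path_graph n) P i = r_mp (path_graph n) P (Suc i)"
    using mem
  proof
    assume "i \<in> A \<and> i \<notin> B \<and> Suc i \<in> B \<and> Suc i \<notin> A"
    then show ?thesis
      using i(1) sub P gdist_set_path_graph_adjacent[of B n i "Suc i"]
        gdist_set_path_graph_adjacent[of A n "Suc i" i]
      by (simp add: r_mp_insert2 gdist_set_path_graph_in)
  next
    assume "i \<in> B \<and> i \<notin> A \<and> Suc i \<in> A \<and> Suc i \<notin> B"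
    then show ?thesis
      using i(1) sub P gdist_set_path_graph_adjacent[of A n i "Suc i"]
        gdist_set_path_graph_adjacent[of B n "Suc i" i]
      by (simp add: r_mp_insert2 gdist_set_path_graph_in)
  qed
  then show False
    using res i(1) by (auto simp: resolving_multiset_partition_def)
qed

lemma not_resolving_three_parts:
  assumes "card P = 3"
  shows "\<not> resolving_multiset_partition (path_graph n) P"
proof
  assume res: "resolving_multiset_partition (path_graph n) P"
  then have part: "partition_on {0..<n} P"
    by (simp add: resolving_multiset_partition_def)
  \<comment> \<open>\<open>T p r q\<close> encodes a segment from \<open>p\<close> to
    \<open>q\<close> that meets all three parts, with \<open>r\<close> a witness for the part in the
    middle. Since \<open>card P = 3\<close>, the equation \<open>P = {A, B, C}\<close> forces the
    parts to be distinct.\<close>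
  define T where "T p r q \<longleftrightarrow> p < r \<and> r < q \<and>
    (\<exists>A B C. P = {A, B, C} \<and> p \<in> A \<and> r \<in> B \<and> q \<in> C)" for p r q :: nat
  have "\<exists>p r q. T p r q"
  proof -
    obtain A B C where P: "P = {A, B, C}" "A \<noteq> B" "A \<noteq> C" "B \<noteq> C"
      using assms by (auto simp: card_3_iff)
    have "A \<inter> B = {}" "A \<inter> C = {}" "B \<inter> C = {}"
      using partition_onD2[OF part] P by (simp_all add: disjoint_def)
    moreover obtain a b c where abc: "a \<in> A" "b \<in> B" "c \<in> C"
      using partition_onD3[OF part] P by auto
    ultimately have "a \<noteq> b" "a \<noteq> c" "b \<noteq> c" by auto
    then consider "a < b" "b < c" | "a < c" "c < b" | "b < a" "a < c"
      | "b < c" "c < a" | "c < a" "a < b" | "c < b" "b < a"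
      by linarith
    then show ?thesis
    proof cases
      case 1 then have "T a b c" unfolding T_def using P abc by blast
      then show ?thesis by blast
    next
      case 2 then have "T a c b" unfolding T_def using P abc by blast
      then show ?thesis by blast
    next
      case 3 then have "T b a c" unfolding T_def using P abc by blast
      then show ?thesis by blast
    next
      case 4 then have "T b c a" unfolding T_def using P abc by blast
      then show ?thesis by blast
    next
      case 5 then have "T c a b" unfolding T_def using P abc by blast
      then show ?thesis by blast
    next
      case 6 then have "T c b a" unfolding T_def using P abc by blast
      then show ?thesis by blast
    qed
  qed
  then obtain k where "\<exists>p r q. T p r q \<and> q - p = k"
    and least: "\<And>p' r' q'. T p' r' q' \<Longrightarrow> k \<le> q' - p'"
    using exists_least_iff[of "\<lambda>k. \<exists>p r q. T p r q \<and> q - p = k"] by (metis not_le)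
  then obtain p r q where T: "T p r q" and k: "k = q - p" by blast
  have min: "T p' r' q' \<Longrightarrow> q - p \<le> q' - p'" for p' r' q'
    using least k by blast
  from T obtain A B C where P: "P = {A, B, C}" and
    prq: "p < r" "r < q" "p \<in> A" "r \<in> B" "q \<in> C"
    by (auto simp: T_def)
  have neq: "A \<noteq> B" "A \<noteq> C" "B \<noteq> C"
    using assms P by (auto simp: card_insert_if split: if_splits)
  have sub: "A \<subseteq> {0..<n}" "B \<subseteq> {0..<n}" "C \<subseteq> {0..<n}" and un: "A \<union> B \<union> C = {0..<n}"
    using partition_onD1[OF part] P by auto
  have disj: "A \<inter> B = {}" "A \<inter> C = {}" "B \<inter> C = {}"
    using partition_onD2[OF part] P neq by (simp_all add: disjoint_def)
  have "q < n" using sub prq by auto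
  \<comment> \<open>The parts may be listed in any order, so that shorter triples with permuted
    parts can be set against \<open>min\<close>.\<close>
  have TI: "T x y z" if "x < y" "y < z" "{X, Y, Z} = {A, B, C}" "x \<in> X" "y \<in> Y" "z \<in> Z"
    for x y z X Y Z
    unfolding T_def using that P by (intro conjI exI[of _ X] exI[of _ Y] exI[of _ Z]) simp_all
  \<comment> \<open>A vertex \<open>x\<close> of \<open>A\<close> strictly inside could replace
    \<open>p\<close>: together with \<open>r\<close> and \<open>q\<close> it forms a triple of
    smaller width, whichever side of \<open>r\<close> it is on. Likewise a vertex of
    \<open>C\<close> could replace \<open>q\<close>.\<close>
  have inner: "x \<in> B" if x: "p < x" "x < q" for x
  proof -
    have "x \<in> A \<union> B \<union> C" using un x \<open>q < n\<close> by auto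
    moreover have False if "x \<in> A"
    proof -
      have "x \<noteq> r" using that prq disj by auto
      then consider "x < r" | "r < x" by linarith
      then show False
      proof cases
        case 1 then show False
          using min[OF TI[of x r q A B C]] that prq x by auto
      next
        case 2 then show False
          using min[OF TI[of r x q B A C]] that prq x by (auto simp: insert_commute)
      qed
    qed
    moreover have False if "x \<in> C"
    proof -
      have "x \<noteq> r" using that prq disj by auto
      then consider "x < r" | "r < x" by linarith
      then show False
      proof cases
        case 1 then show False
          using min[OF TI[of p x r A C B]] that prq x by (auto simp: insert_commute)
      next
        case 2 then show False
          using min[OF TI[of p r x A B C]] that prq x by auto
      qed
    qed
    ultimately show ?thesis by blast
  qed
  have repeq: "u = v" if "r_mp (path_graph n) P u = r_mp (path_graph n) P v" "u < n" "v < n" for u v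
    using res that unfolding resolving_multiset_partition_def
    by (metis atLeastLessThan_iff verts_path_graph zero_le)
  have pB: "Suc p \<in> B" and qB: "q - 1 \<in> B"
    using inner prq by auto
  \<comment> \<open>The nearest vertex of \<open>C\<close> is \<open>q\<close>. For
    \<open>y < p\<close> in \<open>C\<close>, the triple \<open>y\<close>, \<open>p\<close>,
    \<open>Suc p\<close> meets all three parts, so minimality puts \<open>y\<close> too far to the
    left to be closer; between \<open>p\<close> and \<open>q\<close> there is only
    \<open>B\<close>.\<close>
  have "gdist_set (path_graph n) (Suc p) C = q - Suc p"
  proof (rule gdist_set_path_graph_eqI[of _ _ _ q])
    fix y assume y: "y \<in> C"
    have "y \<noteq> p" using y prq disj by auto
    then consider "y < p" | "p < y" "y < q" | "q \<le> y" by linarith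
    then show "q - Suc p \<le> (Suc p - y) + (y - Suc p)"
    proof cases
      case 1 then show ?thesis
        using min[OF TI[of y p "Suc p" C A B]] y prq pB by (auto simp: insert_commute)
    next
      case 2 then show ?thesis using inner[of y] y disj by auto
    qed auto
  qed (use prq sub \<open>q < n\<close> in auto)
  \<comment> \<open>The mirror image, with the triple \<open>q - 1\<close>, \<open>q\<close>,
    \<open>y\<close> for \<open>y\<close> in \<open>A\<close> beyond \<open>q\<close>.\<close>
  moreover have "gdist_set (path_graph n) (q - 1) A = q - Suc p"
  proof (rule gdist_set_path_graph_eqI[of _ _ _ p])
    fix y assume y: "y \<in> A"
    have "y \<noteq> q" using y prq disj by auto
    then consider "q < y" | "p < y" "y < q" | "y \<le> p" by linarith
    then show "q - Suc p \<le> (q - 1 - y) + (y - (q - 1))"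
    proof cases
      case 1 then show ?thesis
        using min[OF TI[of "q - 1" q y B C A]] y prq qB by (auto simp: insert_commute)
    next
      case 2 then show ?thesis using inner[of y] y disj by auto
    qed auto
  qed (use prq sub \<open>q < n\<close> in auto)
  moreover have pA: "gdist_set (path_graph n) (Suc p) A = 1"
    using prq sub pB disj \<open>q < n\<close> by (intro gdist_set_path_graph_adjacent[of _ _ _ p]) auto
  moreover have "gdist_set (path_graph n) (q - 1) C = 1"
    using prq sub qB disj \<open>q < n\<close> by (intro gdist_set_path_graph_adjacent[of _ _ _ q]) auto
  ultimately have "r_mp (path_graph n) P (Suc p) = r_mp (path_graph n) P (q - 1)"
    using P neq pB qB sub by (simp add: r_mp_insert3 gdist_set_path_graph_in add_mset_commute)
  then have "Suc p = q - 1"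
    using repeq prq \<open>q < n\<close> by auto
  then have q: "q = p + 2" using prq by simp
  have "gdist_set (path_graph n) (Suc p) C = 1"
    using prq sub pB disj \<open>q < n\<close> q by (intro gdist_set_path_graph_adjacent[of _ _ _ q]) auto
  then have rep_mid: "r_mp (path_graph n) P (Suc p) = {#0, 1, 1#}"
    using pA P neq pB sub by (simp add: r_mp_insert3 gdist_set_path_graph_in add_mset_commute)
  have "gdist_set (path_graph n) p B = 1"
    using prq sub pB disj \<open>q < n\<close> by (intro gdist_set_path_graph_adjacent[of _ _ _ "Suc p"]) auto
  moreover have "gdist_set (path_graph n) q B = 1"
    using prq sub pB disj \<open>q < n\<close> q by (intro gdist_set_path_graph_adjacent[of _ _ _ "Suc p"]) auto
  ultimately have rep_p: "r_mp (path_graph n) P p = {#0, 1, gdist_set (path_graph n) p C#}"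
    and rep_q: "r_mp (path_graph n) P q = {#0, 1, gdist_set (path_graph n) q A#}"
    using P neq prq sub by (simp_all add: r_mp_insert3 gdist_set_path_graph_in add_mset_commute)
  \<comment> \<open>The value 1 would give \<open>p\<close> or \<open>q\<close> the representation
    of \<open>Suc p\<close>; so both values are 2, and \<open>p\<close> and \<open>q\<close> collide
    with each other.\<close>
  have "gdist_set (path_graph n) p C \<in> {1, 2}"
    using prq sub disj \<open>q < n\<close> q by (intro gdist_set_path_graph_distance_two[of _ _ _ q]) auto
  moreover have "gdist_set (path_graph n) q A \<in> {1, 2}"
    using prq sub disj \<open>q < n\<close> q by (intro gdist_set_path_graph_distance_two[of _ _ _ p]) auto
  moreover have "gdist_set (path_graph n) p C \<noteq> 1"
    using repeq[of p "Suc p"] rep_mid rep_p \<open>q < n\<close> q by auto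
  moreover have "gdist_set (path_graph n) q A \<noteq> 1"
    using repeq[of q "Suc p"] rep_mid rep_q \<open>q < n\<close> q by auto
  ultimately have "r_mp (path_graph n) P p = r_mp (path_graph n) P q"
    using rep_p rep_q by simp
  then show False
    using repeq[of p q] prq \<open>q < n\<close> by simp
qed

lemma resolving_path_graph_card_ge_4:
  assumes "n \<ge> 2" and res: "resolving_multiset_partition (path_graph n) P"
  shows "card P \<ge> 4"
proof (rule ccontr)
  have part: "partition_on {0..<n} P" and fin: "finite P"
    using res by (simp_all add: resolving_multiset_partition_def)
  assume "\<not> ?thesis"
  then consider "card P = 0" | "card P = 1" | "card P = 2" | "card P = 3" by linarith
  then show False
  proof cases
    case 1
    then have "P = {}" using fin by simp
    then show False using partition_onD1[OF part] assms(1) by simp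
  next
    case 2
    then obtain A where "P = {A}" by (auto simp: card_1_singleton_iff)
    moreover from this have "A = {0..<n}" using partition_onD1[OF part] by simp
    \<comment> \<open>Every vertex has distance 0 to the only part; \<open>n \<ge> 2\<close> ensures
      that 0 and 1 are both vertices.\<close>
    ultimately have "r_mp (path_graph n) P 0 = r_mp (path_graph n) P 1"
      using assms(1) by (simp add: r_mp_def gdist_set_path_graph_in)
    then show False
      using res assms(1) by (auto simp: resolving_multiset_partition_def)
  qed (use res not_resolving_two_parts not_resolving_three_parts in blast)+
qed

section \<open>Upper bound: a resolving partition into four parts\<close>

lemma resolving_path_graph_four_parts:
  assumes "n \<ge> 5"
  shows "resolving_multiset_partition (path_graph n) {{0}, {1, 2}, {3}, {4..<n}}"
    (is "resolving_multiset_partition ?G ?P")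
proof -
  \<comment> \<open>An invariant of the multiset, so different values of \<open>s\<close> separate
    vertices. Plain sums would not do: vertices 2 and 3 have distances 2, 0, 1, 2 and 3, 1, 0, 1,
    both with sum 5.\<close>
  define s where "s v = (\<Sum>d\<in>#r_mp ?G ?P v. d\<^sup>2)" for v
  \<comment> \<open>The last part is nonempty and differs from the other three, so the multiset
    really has four entries.\<close>
  have "4 \<in> {4..<n}"
    using assms by simp
  then have "X \<noteq> {4..<n}" if "4 \<notin> X" for X
    using that by blast
  then have neq: "{0} \<noteq> {4..<n}" "{1, 2} \<noteq> {4..<n}" "{3} \<noteq> {4..<n}"
    by simp_all
  have s: "s v = (gdist_set ?G v {0})\<^sup>2 + (gdist_set ?G v {1, 2})\<^sup>2 + (gdist_set ?G v {3})\<^sup>2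
      + (gdist_set ?G v {4..<n})\<^sup>2" for v
    using neq by (simp add: s_def r_mp_def)
  have d0: "gdist_set ?G v {0} = v" if "v < n" for v
    using that by (intro gdist_set_path_graph_eqI[of _ _ _ 0]) auto
  \<comment> \<open>Truncation makes \<open>v - 2\<close> vanish at both 1 and 2; only 0 lies to the
    left of the part. In the same way \<open>4 - v\<close> below vanishes on the whole last
    part.\<close>
  have d12: "gdist_set ?G v {1, 2} = (if v = 0 then 1 else v - 2)" if "v < n" for v
    using that assms
    by (intro gdist_set_path_graph_eqI[of _ _ _ "if v \<le> 1 then 1 else 2"]) auto
  have d3: "gdist_set ?G v {3} = (v - 3) + (3 - v)" if "v < n" for v
    using that assms by (intro gdist_set_path_graph_eqI[of _ _ _ 3]) auto
  have d4: "gdist_set ?G v {4..<n} = 4 - v" if "v < n" for v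
    using that assms by (intro gdist_set_path_graph_eqI[of _ _ _ "max v 4"]) auto
  have s_small: "s 0 = 26" "s 1 = 14" "s 2 = 9" "s 3 = 11" "s 4 = 21"
    using assms by (simp_all add: s d0 d12 d3 d4 power2_eq_square del: One_nat_def)
  have s_large: "s v = v\<^sup>2 + (v - 2)\<^sup>2 + (v - 3)\<^sup>2" if "4 \<le> v" "v < n" for v
    using that by (simp add: s d0 d12 d3 d4 del: One_nat_def)
  have s_mono: "s u < s v" if "4 \<le> u" "u < v" "v < n" for u v
    using that by (simp add: s_large add_strict_mono power_strict_mono)
  \<comment> \<open>The threshold 26 is \<open>s 0\<close>, the largest value on 0 to 3. As
    \<open>s 4 = 21\<close> lies below it, the bound starts at 5, where the first two squares
    already give 25 + 9; vertex 4 is compared with the smaller ones by explicit values.\<close>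
  have s_gt: "s v > 26" if "5 \<le> v" "v < n" for v
  proof -
    have "5\<^sup>2 \<le> v\<^sup>2" "3\<^sup>2 \<le> (v - 2)\<^sup>2"
      using that by (intro power_mono; simp)+
    then show ?thesis using that by (simp add: s_large)
  qed
  have s_neq: "s u \<noteq> s v" if "u < v" "v < n" for u v
  proof -
    consider "4 \<le> u" | "u < 4" "5 \<le> v" | "u < 4" "v < 5" by linarith
    then show ?thesis
    proof cases
      case 1 then show ?thesis using s_mono[of u v] that by simp
    next
      case 2
      then have "u = 0 \<or> u = 1 \<or> u = 2 \<or> u = 3" by linarith
      then show ?thesis using s_gt[of v] 2 that s_small by auto
    next
      case 3
      then have "u = 0 \<or> u = 1 \<or> u = 2 \<or> u = 3" "v = 1 \<or> v = 2 \<or> v = 3 \<or> v = 4"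
        using that by linarith+
      then show ?thesis using s_small that by auto
    qed
  qed
  have "r_mp ?G ?P u \<noteq> r_mp ?G ?P v" if "u < n" "v < n" "u \<noteq> v" for u v
    using s_neq[of u v] s_neq[of v u] that by (auto simp: s_def neq_iff)
  moreover have "partition_on {0..<n} ?P"
  proof (rule partition_onI)
    show "\<Union> ?P = {0..<n}" using assms by auto
    show "disjnt X Y" if "X \<in> ?P" "Y \<in> ?P" "X \<noteq> Y" for X Y
      using that by (auto simp: disjnt_def)
    show "{} \<notin> ?P" using assms by auto
  qed
  ultimately show ?thesis
    by (simp add: resolving_multiset_partition_def)
qed

theorem theorem3p1:
  fixes n :: nat
  assumes "n \<ge> 5"
  shows "mpd (path_graph n) = 4"
proof (rule antisym)
  have "card {{0}, {1, 2}, {3}, {4..<n}} \<le> 4"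
    by (simp add: card_insert_if)
  then have "enat (card {{0}, {1, 2}, {3}, {4..<n}}) \<le> 4"
    by (simp add: numeral_eq_enat)
  then show "mpd (path_graph n) \<le> 4"
    unfolding mpd_def using resolving_path_graph_four_parts[OF assms]
    by (intro INF_lower2) auto
  show "4 \<le> mpd (path_graph n)"
    unfolding mpd_def using resolving_path_graph_card_ge_4[of n] assms
    by (intro INF_greatest) (auto simp: numeral_eq_enat)
qed

end
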